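(* Let $q>2$ and $k>t\ge 0$ be integers. Then there is $n_0=n_0(q,k,t)$ such that for all $n\ge n_0$, the set $\mathcal A'_q(t,k,n)$ is a maximum size anticode of length $n$, constant weight $k$ and diameter $2(k-t)$ over $\mathbb Z_q$; that is, it is an $(n,2(k-t),k)_q$ anticode and every $(n,2(k-t),k)_q$ anticode $\mathcal B$ satisfies $|\mathcal B|\le|\mathcal A'_q(t,k,n)|$.
   Context: $\mathbb Z_q=\{0,1,\dots,q-1\}$ is the alphabet. The Hamming distance of two words of the same length over $\mathbb Z_q$ is the number of coordinates in which they differ; the weight $\mathrm{wt}(x)$ of a word $x$ is the number of its nonzero entries. An $(n,D,k)_q$ anticode is a set of words of length $n$ and weight $k$ over $\mathbb Z_q$ whose diameter (the maximum Hamming distance between two of its words) is $D$. $\mathcal A'_q(t,k,n)$ is the set of all words of length $n$ over $\mathbb Z_q$ of the form $(1,\dots,1,b_1,\dots,b_{n-t})$, starting with $t$ ones, where $b_i\in\mathbb Z_q$ and $\mathrm{wt}(b_1,\dots,b_{n-t})=k-t$. *)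

theory Defs
  imports Main
begin

definition words :: "nat \<Rightarrow> nat \<Rightarrow> nat list set" where
  "words q n = {x. length x = n \<and> set x \<subseteq> {0..<q}}"

(* Only meaningful for words of the same length. *)
definition hamming_dist :: "nat list \<Rightarrow> nat list \<Rightarrow> nat" where
  "hamming_dist x y = card {i. i < length x \<and> x ! i \<noteq> y ! i}"

definition wt :: "nat list \<Rightarrow> nat" where
  "wt x = card {i. i < length x \<and> x ! i \<noteq> 0}"

(* Meaningful for finite nonempty sets of words of equal length. *)
definition hamming_diameter :: "nat list set \<Rightarrow> nat" where
  "hamming_diameter B = Max {hamming_dist x y | x y. x \<in> B \<and> y \<in> B}"

(* The diameter of the empty set is undefined, hence the nonemptiness condition. *)
definition is_anticode :: "nat \<Rightarrow> nat \<Rightarrow> nat \<Rightarrow> nat \<Rightarrow> nat list set \<Rightarrow> bool" where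
  "is_anticode q n D k B \<longleftrightarrow>
     B \<subseteq> words q n \<and> (\<forall>x\<in>B. wt x = k) \<and> B \<noteq> {} \<and> hamming_diameter B = D"

(* The constraints on b are written additively to avoid truncated subtraction. *)
definition anticode_A' :: "nat \<Rightarrow> nat \<Rightarrow> nat \<Rightarrow> nat \<Rightarrow> nat list set" where
  "anticode_A' q t k n =
     {replicate t 1 @ b | b. t + length b = n \<and> set b \<subseteq> {0..<q} \<and> t + wt b = k}"

end

theory Submission
  imports Defs
begin

text \<open>
  Two words of weight \<open>k\<close> whose supports share \<open>c\<close> positions, \<open>a\<close> of them carrying the same
  letter, are at distance \<open>2 * k - c - a\<close>.  As \<open>a \<le> c\<close>, a distance of at most \<open>2 * (k - t)\<close>
  means that the supports share at least \<open>t\<close> positions, and that the words agree on all shared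
  positions if there are exactly \<open>t\<close> of them (\<open>supp_meet_of_hamming_dist_le\<close>).

  As in the Erdos--Ko--Rado theorem for large ground sets, this forces a dichotomy
  (\<open>star_or_kernel\<close>).  Either all words of the anticode carry the same nonzero letters on
  some \<open>t\<close> positions (a star), or some set of at most \<open>3 * k\<close> positions (a kernel) meets every
  support in more than \<open>t\<close> positions.  An anticode of the first kind is contained in a copy of
  \<open>anticode_A' q t k n\<close> and so is no larger.  An anticode of the second kind has \<open>t + 1\<close>
  support positions chosen from a set of bounded size and only \<open>k - t - 1\<close> free ones, so it has
  \<open>O(n ^ (k - t - 1))\<close> words, whereas \<open>anticode_A' q t k n\<close> has
  \<open>(n - t choose k - t) * (q - 1) ^ (k - t)\<close>.  The ratio of the two binomial coefficients
  involved is exactly \<open>(n - t) / (k - t)\<close>, which yields an explicit threshold for \<open>n\<close>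
  (\<open>anticode_card_le\<close>).
\<close>

section \<open>Supports, weights and distances\<close>

definition supp :: "nat list \<Rightarrow> nat set" where
  "supp w = {i. i < length w \<and> w ! i \<noteq> 0}"

lemma finite_supp [simp]: "finite (supp w)"
  by (simp add: supp_def)

lemma wt_eq_card_supp: "wt w = card (supp w)"
  by (simp add: wt_def supp_def)

lemma supp_subset_lessThan: "w \<in> words q n \<Longrightarrow> supp w \<subseteq> {..<n}"
  by (auto simp: supp_def words_def)

lemma mem_words_iff: "w \<in> words q n \<longleftrightarrow> length w = n \<and> (\<forall>i<n. w ! i < q)"
  by (fastforce simp: words_def in_set_conv_nth)

lemma finite_words: "finite (words q n)"
  using finite_lists_length_eq[of "{0..<q}" n] by (simp add: words_def conj_commute)

text \<open>
  Weights and distances both count positions, so both are additive under concatenation.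
\<close>
lemma card_nth_append_split:
  "card {i. i < m + n \<and> P i} = card {i. i < m \<and> P i} + card {i. i < n \<and> P (m + i)}" for m n :: nat
proof -
  have "{i. i < m + n \<and> P i} = {i. i < m \<and> P i} \<union> (+) m ` {i. i < n \<and> P (m + i)}"
    by (auto simp: image_iff) (metis add_less_cancel_left le_add_diff_inverse not_le)
  moreover have "card ((+) m ` {i. i < n \<and> P (m + i)}) = card {i. i < n \<and> P (m + i)}"
    by (intro card_image) (auto simp: inj_on_def)
  ultimately show ?thesis
    by (simp add: card_Un_disjoint[of "{i. i < m \<and> P i}"] disjoint_iff image_iff)
qed

lemma wt_append: "wt (x @ y) = wt x + wt y"
  using card_nth_append_split[of "length x" "length y" "\<lambda>i. (x @ y) ! i \<noteq> 0"]
  by (simp add: wt_def nth_append cong: conj_cong)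

lemma hamming_dist_append:
  assumes "length x = length x'"
  shows "hamming_dist (x @ y) (x' @ y') = hamming_dist x x' + hamming_dist y y'"
  using card_nth_append_split[of "length x" "length y" "\<lambda>i. (x @ y) ! i \<noteq> (x' @ y') ! i"] assms
  by (simp add: hamming_dist_def nth_append cong: conj_cong)

lemma wt_replicate: "wt (replicate m a) = (if a = 0 then 0 else m)"
  by (simp add: wt_def cong: conj_cong)

lemma hamming_dist_replicate:
  "hamming_dist (replicate m a) (replicate m b) = (if a = b then 0 else m)"
  by (simp add: hamming_dist_def cong: conj_cong)

lemma hamming_dist_self: "hamming_dist x x = 0"
  by (simp add: hamming_dist_def)

lemma hamming_dist_le_wt:
  assumes "length x = length y"
  shows "hamming_dist x y \<le> wt x + wt y"
proof -
  have "hamming_dist x y \<le> card (supp x \<union> supp y)"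
    unfolding hamming_dist_def using assms by (intro card_mono) (auto simp: supp_def)
  also have "\<dots> \<le> wt x + wt y" by (simp add: wt_eq_card_supp card_Un_le)
  finally show ?thesis .
qed

section \<open>Counting words of constant weight\<close>

lemma card_lists_coordinatewise:
  "card {w. length w = n \<and> (\<forall>i<n. w ! i \<in> F i)} = (\<Prod>i<n. card (F i))"
proof (induction n)
  case 0
  have "{w. length w = 0 \<and> (\<forall>i<0. w ! i \<in> F i)} = {[]}" by auto
  then show ?case by simp
next
  case (Suc n)
  let ?A = "{w. length w = n \<and> (\<forall>i<n. w ! i \<in> F i)}"
  have "{w. length w = Suc n \<and> (\<forall>i<Suc n. w ! i \<in> F i)} = (\<lambda>(w, a). w @ [a]) ` (?A \<times> F n)"
  proof (intro equalityI subsetI)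
    fix w assume w: "w \<in> {w. length w = Suc n \<and> (\<forall>i<Suc n. w ! i \<in> F i)}"
    then have "w \<noteq> []" by auto
    then have "w = butlast w @ [last w]" by simp
    moreover have "last w = w ! n" using w \<open>w \<noteq> []\<close> by (simp add: last_conv_nth)
    ultimately show "w \<in> (\<lambda>(w, a). w @ [a]) ` (?A \<times> F n)"
      using w by (intro image_eqI[of _ _ "(butlast w, last w)"]) (auto simp: nth_butlast)
  qed (auto simp: nth_append less_Suc_eq)
  moreover have "inj_on (\<lambda>(w, a). w @ [a]) (?A \<times> F n)"
    by (auto simp: inj_on_def)
  ultimately show ?case
    using Suc by (simp add: card_image card_cartesian_product)
qed

lemma card_supersets_of_card:
  fixes V :: "'a set"
  assumes "finite V" and "R \<subseteq> V" and "card R \<le> k"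
  shows "card {S. R \<subseteq> S \<and> S \<subseteq> V \<and> card S = k} = (card V - card R) choose (k - card R)"
proof -
  have fR: "finite R" using assms finite_subset by blast
  have "{S. R \<subseteq> S \<and> S \<subseteq> V \<and> card S = k}
      = (\<union>) R ` {S. S \<subseteq> V - R \<and> card S = k - card R}"
  proof (intro equalityI subsetI)
    fix S assume S: "S \<in> {S. R \<subseteq> S \<and> S \<subseteq> V \<and> card S = k}"
    then have "S = R \<union> (S - R)" by auto
    moreover have "card (S - R) = k - card R" using S fR by (auto simp: card_Diff_subset)
    ultimately show "S \<in> (\<union>) R ` {S. S \<subseteq> V - R \<and> card S = k - card R}"
      using S by blast
  next
    fix S assume "S \<in> (\<union>) R ` {S. S \<subseteq> V - R \<and> card S = k - card R}"
    then obtain X where X: "S = R \<union> X" "X \<subseteq> V - R" "card X = k - card R" by auto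
    moreover have "finite X" using X assms finite_subset by blast
    then have "card (R \<union> X) = card R + card X"
      using X fR by (intro card_Un_disjoint) auto
    ultimately show "S \<in> {S. R \<subseteq> S \<and> S \<subseteq> V \<and> card S = k}" using assms by auto
  qed
  moreover have "inj_on ((\<union>) R) {S. S \<subseteq> V - R \<and> card S = k - card R}"
    by (auto simp: inj_on_def)
  moreover have "card (V - R) = card V - card R" using fR assms by (simp add: card_Diff_subset)
  ultimately show ?thesis
    using n_subsets[of "V - R" "k - card R"] assms by (simp add: card_image)
qed

text \<open>
  One count serves both halves of the dichotomy: with singletons \<open>F i\<close> it gives the size of
  the extremal anticode and of its copies on other positions, and with \<open>F i = {1..<q}\<close> it
  counts the words whose support contains \<open>R\<close>.  Classify the words by their support \<open>S\<close>, a
  \<open>k\<close>-set containing \<open>R\<close>; once \<open>S\<close> is fixed, the coordinates are independent.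
\<close>
lemma card_constant_weight_prescribed:
  assumes "0 < q" and R: "R \<subseteq> {..<n}" "card R \<le> k" and F: "\<And>i. i \<in> R \<Longrightarrow> F i \<subseteq> {1..<q}"
  shows "card {w \<in> words q n. wt w = k \<and> (\<forall>i\<in>R. w ! i \<in> F i)}
       = ((n - card R) choose (k - card R)) * ((\<Prod>i\<in>R. card (F i)) * (q - 1) ^ (k - card R))"
proof -
  define \<S> where "\<S> = {S. R \<subseteq> S \<and> S \<subseteq> {..<n} \<and> card S = k}"
  define W where "W S = {w \<in> words q n. supp w = S \<and> (\<forall>i\<in>R. w ! i \<in> F i)}" for S
  have "finite \<S>" by (rule finite_subset[of _ "Pow {..<n}"]) (auto simp: \<S>_def)
  have finW: "finite (W S)" for S using finite_words[of q n] by (simp add: W_def)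
  have split: "{w \<in> words q n. wt w = k \<and> (\<forall>i\<in>R. w ! i \<in> F i)} = (\<Union>S\<in>\<S>. W S)"
  proof -
    have "supp w \<in> \<S>" if "w \<in> words q n" "wt w = k" "\<forall>i\<in>R. w ! i \<in> F i" for w
      using that R F supp_subset_lessThan[of w q n]
      by (fastforce simp: \<S>_def wt_eq_card_supp supp_def mem_words_iff)
    then show ?thesis by (auto simp: W_def \<S>_def wt_eq_card_supp)
  qed
  have each: "card (W S) = (\<Prod>i\<in>R. card (F i)) * (q - 1) ^ (k - card R)" if S: "S \<in> \<S>" for S
  proof -
    have RS: "R \<subseteq> S" "S \<subseteq> {..<n}" "card S = k" using S by (auto simp: \<S>_def)
    have fin: "finite S" "finite R" using RS finite_subset[of _ "{..<n}"] by auto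
    define G where "G i = (if i \<in> R then F i else if i \<in> S then {1..<q} else {0})" for i
    have "W S = {w. length w = n \<and> (\<forall>i<n. w ! i \<in> G i)}"
    proof (intro equalityI subsetI)
      fix w assume "w \<in> W S"
      then show "w \<in> {w. length w = n \<and> (\<forall>i<n. w ! i \<in> G i)}"
        by (auto simp: W_def G_def mem_words_iff supp_def)
    next
      fix w assume w: "w \<in> {w. length w = n \<and> (\<forall>i<n. w ! i \<in> G i)}"
      have range: "w ! i < q \<and> (w ! i \<noteq> 0 \<longleftrightarrow> i \<in> S)" if "i < n" for i
      proof -
        have "w ! i \<in> G i" using w that by blast
        then show ?thesis using F[of i] RS \<open>0 < q\<close> by (auto simp: G_def split: if_splits)
      qed
      have "\<forall>i\<in>R. w ! i \<in> F i"
      proof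
        fix i assume "i \<in> R"
        then have "w ! i \<in> G i" using w R by auto
        then show "w ! i \<in> F i" using \<open>i \<in> R\<close> by (simp add: G_def)
      qed
      then show "w \<in> W S" using w range RS by (auto simp: W_def mem_words_iff supp_def)
    qed
    then have "card (W S) = (\<Prod>i<n. card (G i))" by (simp add: card_lists_coordinatewise)
    also have "\<dots> = (\<Prod>i\<in>S. card (G i))"
      using RS by (intro prod.mono_neutral_right) (auto simp: G_def)
    also have "\<dots> = (\<Prod>i\<in>S - R. card (G i)) * (\<Prod>i\<in>R. card (G i))"
      using RS fin by (intro prod.subset_diff) auto
    also have "(\<Prod>i\<in>S - R. card (G i)) = (q - 1) ^ card (S - R)"
      by (simp add: G_def)
    also have "(\<Prod>i\<in>R. card (G i)) = (\<Prod>i\<in>R. card (F i))"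
      by (simp add: G_def)
    also have "card (S - R) = k - card R"
      using RS fin by (simp add: card_Diff_subset)
    finally show ?thesis by simp
  qed
  have "card (\<Union>S\<in>\<S>. W S) = (\<Sum>S\<in>\<S>. card (W S))"
    using \<open>finite \<S>\<close> finW by (intro card_UN_disjoint) (auto simp: W_def)
  also have "\<dots> = card \<S> * ((\<Prod>i\<in>R. card (F i)) * (q - 1) ^ (k - card R))"
    using each by simp
  also have "card \<S> = (n - card R) choose (k - card R)"
    unfolding \<S>_def using card_supersets_of_card[of "{..<n}" R k] R by simp
  finally show ?thesis using split by simp
qed

text \<open>
  Each such word has some \<open>j\<close>-subset of \<open>U\<close> inside its support; sum over all of them.  Bounding
  the number of these subsets by \<open>2 ^ card U\<close> is wasteful, but all that matters is that the
  bound does not involve \<open>n\<close>.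
\<close>
lemma card_words_meeting_kernel_le:
  assumes "0 < q" "j \<le> k" and U: "U \<subseteq> {..<n}"
    and B: "B \<subseteq> words q n" "\<And>w. w \<in> B \<Longrightarrow> wt w = k" "\<And>w. w \<in> B \<Longrightarrow> j \<le> card (supp w \<inter> U)"
  shows "card B \<le> 2 ^ card U * (((n - j) choose (k - j)) * (q - 1) ^ k)"
proof -
  define M where "M R = {w \<in> words q n. wt w = k \<and> (\<forall>i\<in>R. w ! i \<in> {1..<q})}" for R
  define \<R> where "\<R> = {R. R \<subseteq> U \<and> card R = j}"
  have fU: "finite U" using U finite_subset by blast
  have fR: "finite \<R>" unfolding \<R>_def by (rule finite_subset[of _ "Pow U"]) (use fU in auto)
  have fM: "finite (M R)" for R using finite_words[of q n] by (simp add: M_def)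
  have "B \<subseteq> (\<Union>R\<in>\<R>. M R)"
  proof
    fix w assume w: "w \<in> B"
    then obtain R where R: "R \<subseteq> supp w \<inter> U" "card R = j"
      using B(3) obtain_subset_with_card_n by metis
    moreover have "w \<in> M R"
      using w B R by (fastforce simp: M_def mem_words_iff supp_def)
    ultimately show "w \<in> (\<Union>R\<in>\<R>. M R)" by (auto simp: \<R>_def)
  qed
  then have "card B \<le> card (\<Union>R\<in>\<R>. M R)"
    using fR fM by (intro card_mono) auto
  also have "\<dots> \<le> (\<Sum>R\<in>\<R>. card (M R))" using fR by (rule card_UN_le)
  also have "\<dots> = (\<Sum>R\<in>\<R>. ((n - j) choose (k - j)) * (q - 1) ^ k)"
  proof (intro sum.cong refl)
    fix R assume "R \<in> \<R>"
    then have R: "R \<subseteq> {..<n}" "card R = j" using U by (auto simp: \<R>_def)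
    show "card (M R) = ((n - j) choose (k - j)) * (q - 1) ^ k"
      using card_constant_weight_prescribed[of q R n k "\<lambda>_. {1..<q}"] R assms
      by (simp add: M_def power_add[symmetric])
  qed
  also have "\<dots> = card \<R> * (((n - j) choose (k - j)) * (q - 1) ^ k)" by simp
  also have "\<dots> \<le> 2 ^ card U * (((n - j) choose (k - j)) * (q - 1) ^ k)"
  proof (intro mult_right_mono)
    have "card \<R> \<le> card (Pow U)" using fU by (intro card_mono) (auto simp: \<R>_def)
    then show "card \<R> \<le> 2 ^ card U" using fU by (simp add: card_Pow)
  qed simp
  finally show ?thesis .
qed

section \<open>The extremal anticode\<close>

lemma anticode_A'_eq:
  assumes "1 < q" "t \<le> n"
  shows "anticode_A' q t k n = {w \<in> words q n. wt w = k \<and> (\<forall>i\<in>{..<t}. w ! i \<in> {1})}"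
proof (intro equalityI subsetI)
  fix w assume "w \<in> anticode_A' q t k n"
  then show "w \<in> {w \<in> words q n. wt w = k \<and> (\<forall>i\<in>{..<t}. w ! i \<in> {1})}"
    using assms by (auto simp: anticode_A'_def words_def wt_append wt_replicate nth_append)
next
  fix w assume w: "w \<in> {w \<in> words q n. wt w = k \<and> (\<forall>i\<in>{..<t}. w ! i \<in> {1})}"
  then have len: "length w = n" by (simp add: words_def)
  have "take t w = replicate t 1"
    using w len assms by (intro nth_equalityI) auto
  then have eq: "w = replicate t 1 @ drop t w" by (metis append_take_drop_id)
  then have "k = t + wt (drop t w)" using w wt_append[of "replicate t 1" "drop t w"]
    by (simp add: wt_replicate)
  moreover have "set (drop t w) \<subseteq> {0..<q}"
    using w set_drop_subset[of t w] by (auto simp: words_def)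
  ultimately show "w \<in> anticode_A' q t k n"
    unfolding anticode_A'_def using eq len assms by fastforce
qed

lemma card_anticode_A':
  assumes "1 < q" "t \<le> k" "t \<le> n"
  shows "card (anticode_A' q t k n) = ((n - t) choose (k - t)) * (q - 1) ^ (k - t)"
  using card_constant_weight_prescribed[of q "{..<t}" n k "\<lambda>_. {1}"] assms
  by (simp add: anticode_A'_eq)

text \<open>
  Outside the common ones, each word has \<open>k - t\<close> nonzero entries, so two words differ in at most
  \<open>2 * (k - t)\<close> positions.  The bound on \<open>n\<close> leaves room for two words \<open>u\<close> and \<open>v\<close> whose
  remaining supports are disjoint, which attain this distance.
\<close>
lemma anticode_A'_is_anticode:
  assumes "1 < q" "t \<le> k" "2 * k \<le> n + t"
  shows "is_anticode q n (2 * (k - t)) k (anticode_A' q t k n)"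
proof -
  define m where "m = k - t"
  define r where "r = n - (t + 2 * m)"
  have k: "k = t + m" and n: "n = t + 2 * m + r" using assms by (auto simp: m_def r_def)
  let ?A = "anticode_A' q t k n"
  let ?D = "{hamming_dist x y | x y. x \<in> ?A \<and> y \<in> ?A}"
  have A: "?A \<subseteq> words q n" "\<forall>w\<in>?A. wt w = k"
    using anticode_A'_eq[of q t n k] assms n by auto
  define u :: "nat list" where "u = replicate t 1 @ replicate m 1 @ replicate m 0 @ replicate r 0"
  define v :: "nat list" where "v = replicate t 1 @ replicate m 0 @ replicate m 1 @ replicate r 0"
  have u: "u \<in> ?A"
    unfolding anticode_A'_def mem_Collect_eq u_def using assms k n
    by (intro exI[of _ "replicate m 1 @ replicate m 0 @ replicate r 0"] conjI refl)
      (auto simp: wt_append wt_replicate)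
  have v: "v \<in> ?A"
    unfolding anticode_A'_def mem_Collect_eq v_def using assms k n
    by (intro exI[of _ "replicate m 0 @ replicate m 1 @ replicate r 0"] conjI refl)
      (auto simp: wt_append wt_replicate)
  have uv: "hamming_dist u v = 2 * m"
    by (simp add: u_def v_def hamming_dist_append hamming_dist_replicate)
  have le: "hamming_dist x y \<le> 2 * m" if xy: "x \<in> ?A" "y \<in> ?A" for x y
  proof -
    obtain b c where bc: "x = replicate t 1 @ b" "t + length b = n" "t + wt b = k"
        "y = replicate t 1 @ c" "t + length c = n" "t + wt c = k"
      using xy unfolding anticode_A'_def by blast
    then have bc': "length b = length c" "wt b = m" "wt c = m" using k by linarith+
    have "hamming_dist x y = hamming_dist b c"
      unfolding bc(1,4) by (simp add: hamming_dist_append hamming_dist_self)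
    then show ?thesis using hamming_dist_le_wt[of b c] bc' by simp
  qed
  have "Max ?D = 2 * m"
  proof (rule Max_eqI)
    show "finite ?D" using le by (intro finite_subset[OF _ finite_atMost[of "2 * m"]]) auto
    show "2 * m \<in> ?D" unfolding mem_Collect_eq using u v uv by metis
  qed (use le in auto)
  then show ?thesis
    using A u unfolding is_anticode_def hamming_diameter_def m_def by blast
qed

section \<open>The structure of families of small diameter\<close>

text \<open>
  The words differ on the symmetric difference of their supports, which has \<open>2 * (k - c)\<close>
  elements when the supports share \<open>c\<close> positions, and on the set \<open>E\<close> of shared positions with
  different letters.  Hence \<open>2 * (k - c) + card E \<le> 2 * (k - t)\<close>, which leaves nothing for
  \<open>E\<close> if \<open>c = t\<close>.
\<close>
lemma supp_meet_of_hamming_dist_le: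
  assumes xy: "length x = length y" "wt x = k" "wt y = k" "t \<le> k"
    and d: "hamming_dist x y \<le> 2 * (k - t)"
  shows "t \<le> card (supp x \<inter> supp y)"
    and "card (supp x \<inter> supp y) = t \<Longrightarrow> i \<in> supp x \<inter> supp y \<Longrightarrow> x ! i = y ! i"
proof -
  define c where "c = card (supp x \<inter> supp y)"
  define E where "E = {i \<in> supp x \<inter> supp y. x ! i \<noteq> y ! i}"
  have "(supp x - supp y) \<union> (supp y - supp x) \<union> E \<subseteq> {i. i < length x \<and> x ! i \<noteq> y ! i}"
    using xy by (auto simp: supp_def E_def)
  then have "card ((supp x - supp y) \<union> (supp y - supp x) \<union> E) \<le> hamming_dist x y"
    unfolding hamming_dist_def by (intro card_mono) auto
  moreover have "card ((supp x - supp y) \<union> (supp y - supp x) \<union> E)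
      = card (supp x - supp y) + card (supp y - supp x) + card E"
  proof -
    have "finite E" by (simp add: E_def)
    then show ?thesis
      by (subst card_Un_disjoint; (subst card_Un_disjoint)?) (auto simp: E_def)
  qed
  moreover have "card (supp x - supp y) = k - c" "card (supp y - supp x) = k - c"
    using xy card_Diff_subset_Int[of "supp x" "supp y"] card_Diff_subset_Int[of "supp y" "supp x"]
    by (simp_all add: c_def wt_eq_card_supp Int_commute)
  moreover have "c \<le> k"
    unfolding c_def using xy by (metis Int_lower1 card_mono finite_supp wt_eq_card_supp)
  ultimately have le: "2 * (k - c) + card E \<le> 2 * (k - t)" "c \<le> k" using d by auto
  then show "t \<le> card (supp x \<inter> supp y)" using \<open>t \<le> k\<close> unfolding c_def by linarith
  assume "card (supp x \<inter> supp y) = t" and i: "i \<in> supp x \<inter> supp y"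
  then have "card E = 0" using le by (simp add: c_def)
  moreover have "finite E" by (simp add: E_def)
  ultimately have "E = {}" by simp
  then show "x ! i = y ! i" using i by (auto simp: E_def)
qed

text \<open>
  If no two supports meet in exactly \<open>t\<close> positions, any single support is a kernel.  Otherwise
  let the supports of \<open>x\<close> and \<open>y\<close> meet in a \<open>t\<close>-set \<open>T\<close>, and let \<open>z\<close> be a word that disagrees
  with \<open>x\<close> somewhere on \<open>T\<close>; if there is none, the words form a star over \<open>T\<close>.  The three
  supports together are a kernel: a support meeting their union in only \<open>t\<close> positions would
  meet each of the three in these same positions, hence in \<open>T\<close>, and its word would have to
  agree on \<open>T\<close> with both \<open>x\<close> and \<open>z\<close>.
\<close>
lemma star_or_kernel [consumes 5, case_names star kernel]:
  assumes B: "B \<subseteq> words q n" "\<forall>w\<in>B. wt w = k" "B \<noteq> {}" and "t \<le> k"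
    and d: "\<forall>x\<in>B. \<forall>y\<in>B. hamming_dist x y \<le> 2 * (k - t)"
  obtains (star) x T where "x \<in> B" "T \<subseteq> supp x" "card T = t"
      "\<And>w i. w \<in> B \<Longrightarrow> i \<in> T \<Longrightarrow> w ! i = x ! i"
  | (kernel) U where "U \<subseteq> {..<n}" "card U \<le> 3 * k" "\<And>w. w \<in> B \<Longrightarrow> t < card (supp w \<inter> U)"
proof -
  have len: "length w = n" if "w \<in> B" for w using that B by (auto simp: mem_words_iff)
  have meet: "t \<le> card (supp x \<inter> supp y)" if "x \<in> B" "y \<in> B" for x y
    using supp_meet_of_hamming_dist_le(1)[of x y k t] that len[OF that(1)] len[OF that(2)] B(2) d \<open>t \<le> k\<close>
    by simp
  have agree: "x ! i = y ! i"
    if "x \<in> B" "y \<in> B" "card (supp x \<inter> supp y) = t" "i \<in> supp x \<inter> supp y" for x y i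
    using supp_meet_of_hamming_dist_le(2)[of x y k t i] that len[OF that(1)] len[OF that(2)] B(2) d
      \<open>t \<le> k\<close>
    by simp
  have sub: "supp w \<subseteq> {..<n}" if "w \<in> B" for w using that B supp_subset_lessThan by blast
  have supp_card: "card (supp w) = k" if "w \<in> B" for w using that B by (simp add: wt_eq_card_supp)
  obtain x0 where x0: "x0 \<in> B" using B by blast
  show thesis
  proof (cases "\<exists>x\<in>B. \<exists>y\<in>B. card (supp x \<inter> supp y) = t")
    case False
    show thesis
    proof (rule kernel)
      show "supp x0 \<subseteq> {..<n}" using sub x0 by blast
      show "card (supp x0) \<le> 3 * k" using supp_card[OF x0] by simp
      show "t < card (supp w \<inter> supp x0)" if "w \<in> B" for w
        using False meet[OF that x0] that x0 by (metis le_neq_implies_less)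
    qed
  next
    case True
    then obtain x y where x: "x \<in> B" and y: "y \<in> B" and xy: "card (supp x \<inter> supp y) = t" by blast
    define T where "T = supp x \<inter> supp y"
    show thesis
    proof (cases "\<forall>w\<in>B. \<forall>i\<in>T. w ! i = x ! i")
      case True
      then show thesis using star[of x T] x xy unfolding T_def by blast
    next
      case False
      then obtain z i where z: "z \<in> B" and i: "i \<in> T" "z ! i \<noteq> x ! i" by blast
      define U where "U = supp x \<union> supp y \<union> supp z"
      show thesis
      proof (rule kernel[of U])
        show "U \<subseteq> {..<n}" using x y z sub by (auto simp: U_def)
        have "card U \<le> card (supp x) + card (supp y) + card (supp z)"
          unfolding U_def by (meson card_Un_le add_le_mono1 le_trans)
        then show "card U \<le> 3 * k" using x y z supp_card by simp
        fix w assume w: "w \<in> B"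
        show "t < card (supp w \<inter> U)"
        proof (rule ccontr)
          assume "\<not> t < card (supp w \<inter> U)"
          then have small: "card (supp w \<inter> U) \<le> t" by simp
          have meets_in_all: "supp w \<inter> supp v = supp w \<inter> U"
            if "v \<in> B" "supp v \<subseteq> U" for v
          proof (rule card_subset_eq)
            show sub: "supp w \<inter> supp v \<subseteq> supp w \<inter> U" using that by blast
            show fin: "finite (supp w \<inter> U)" by simp
            show "card (supp w \<inter> supp v) = card (supp w \<inter> U)"
              using small meet[OF w \<open>v \<in> B\<close>] card_mono[OF fin sub] by simp
          qed
          have wx: "supp w \<inter> supp x = supp w \<inter> U"
            and wy: "supp w \<inter> supp y = supp w \<inter> U"
            and wz: "supp w \<inter> supp z = supp w \<inter> U"
            using meets_in_all x y z by (auto simp: U_def)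
          have card_wU: "card (supp w \<inter> U) = t" using small meet[OF w x] wx by simp
          have "supp w \<inter> U = T"
            using wx wy card_wU xy by (intro card_subset_eq) (auto simp: T_def)
          then have "w ! i = x ! i" "w ! i = z ! i"
            using agree[OF w x] agree[OF w z] wx wz card_wU i by auto
          then show False using i by simp
        qed
      qed
    qed
  qed
qed

section \<open>The upper bound\<close>

lemma hamming_dist_le_diameter:
  assumes "is_anticode q n D k B" "x \<in> B" "y \<in> B"
  shows "hamming_dist x y \<le> D"
proof -
  have "finite B" using assms finite_words[of q n] by (auto simp: is_anticode_def intro: finite_subset)
  moreover have "{hamming_dist x y | x y. x \<in> B \<and> y \<in> B} = (\<lambda>(x, y). hamming_dist x y) ` (B \<times> B)"
    by auto
  ultimately have "finite {hamming_dist x y | x y. x \<in> B \<and> y \<in> B}" by simp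
  then have "hamming_dist x y \<le> hamming_diameter B"
    unfolding hamming_diameter_def using assms by (intro Max_ge) auto
  then show ?thesis using assms by (simp add: is_anticode_def)
qed

text \<open>
  In the kernel case the factor \<open>2 ^ (3 * k) * (q - 1) ^ k\<close> has to be absorbed in passing from
  \<open>N choose m\<close> to \<open>Suc N choose Suc m\<close>, where \<open>N = n - t - 1\<close> and \<open>m = k - t - 1\<close>.  Since the
  latter is \<open>Suc N / Suc m\<close> times the former and \<open>Suc m \<le> k\<close>, the assumed lower bound on \<open>n\<close>
  is what is needed.
\<close>
lemma anticode_card_le:
  assumes "1 < q" "t < k" and n: "t + k * 8 ^ k * (q - 1) ^ k \<le> n"
    and B: "is_anticode q n (2 * (k - t)) k B"
  shows "card B \<le> ((n - t) choose (k - t)) * (q - 1) ^ (k - t)"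
proof -
  have Bw: "B \<subseteq> words q n" "\<forall>w\<in>B. wt w = k" "B \<noteq> {}"
    using B by (auto simp: is_anticode_def)
  have d: "\<forall>x\<in>B. \<forall>y\<in>B. hamming_dist x y \<le> 2 * (k - t)"
    using hamming_dist_le_diameter[OF B] by blast
  from Bw less_imp_le[OF \<open>t < k\<close>] d show ?thesis
  proof (cases rule: star_or_kernel)
    case (star x T)
    have T: "T \<subseteq> {..<n}" using star Bw supp_subset_lessThan by blast
    let ?M = "{w \<in> words q n. wt w = k \<and> (\<forall>i\<in>T. w ! i \<in> {x ! i})}"
    have x: "x ! i \<in> {1..<q}" if "i \<in> T" for i
      using that star(1,2) Bw(1) T by (fastforce simp: supp_def mem_words_iff)
    have "B \<subseteq> ?M" using star(4) Bw by blast
    then have "card B \<le> card ?M" using finite_words[of q n] by (intro card_mono) auto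
    also have "\<dots> = ((n - t) choose (k - t)) * (q - 1) ^ (k - t)"
      using card_constant_weight_prescribed[of q T n k "\<lambda>i. {x ! i}"] T x star(3) assms by simp
    finally show ?thesis .
  next
    case (kernel U)
    define m where "m = k - Suc t"
    define N where "N = n - Suc t"
    have "0 < k * 8 ^ k * (q - 1) ^ k" using assms by simp
    then have "t < n" using n by linarith
    then have km: "k - t = Suc m" and nN: "n - t = Suc N"
      using assms by (auto simp: m_def N_def)
    have "card B \<le> 2 ^ card U * ((N choose m) * (q - 1) ^ k)"
      unfolding N_def m_def
      using card_words_meeting_kernel_le[of q "Suc t" k U n B] kernel(1,3) Bw assms(1,2)
      by (simp add: Suc_le_eq)
    also have "\<dots> \<le> 8 ^ k * ((N choose m) * (q - 1) ^ k)"
    proof (intro mult_right_mono)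
      have "(2::nat) ^ card U \<le> 2 ^ (3 * k)" using kernel(2) by (intro power_increasing) auto
      then show "(2::nat) ^ card U \<le> 8 ^ k" by (simp add: power_mult)
    qed simp
    also have "\<dots> \<le> Suc N choose Suc m"
    proof -
      have "Suc m * (8 ^ k * (q - 1) ^ k) \<le> k * (8 ^ k * (q - 1) ^ k)"
        using km by (intro mult_right_mono) auto
      also have "\<dots> \<le> Suc N" using n nN by (simp add: mult.assoc)
      finally have "Suc m * (8 ^ k * (q - 1) ^ k) * (N choose m) \<le> Suc N * (N choose m)"
        by (rule mult_right_mono) simp
      also have "\<dots> = Suc m * (Suc N choose Suc m)"
        by (simp only: Suc_times_binomial_eq mult.commute)
      finally have "Suc m * (8 ^ k * ((N choose m) * (q - 1) ^ k)) \<le> Suc m * (Suc N choose Suc m)"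
        by (simp only: ac_simps)
      then show ?thesis by (simp only: Suc_mult_le_cancel1)
    qed
    also have "\<dots> \<le> (Suc N choose Suc m) * (q - 1) ^ (k - t)" using assms by simp
    finally show ?thesis by (simp only: km nN)
  qed
qed

theorem theorem8:
  fixes q k t :: nat
  assumes "q > 2" and "k > t"
  shows "\<exists>n0. \<forall>n\<ge>n0.
           is_anticode q n (2 * (k - t)) k (anticode_A' q t k n) \<and>
           (\<forall>B. is_anticode q n (2 * (k - t)) k B \<longrightarrow> card B \<le> card (anticode_A' q t k n))"
proof (intro exI allI impI conjI)
  fix n assume n: "2 * k + t + k * 8 ^ k * (q - 1) ^ k \<le> n"
  show "is_anticode q n (2 * (k - t)) k (anticode_A' q t k n)"
    using assms n by (intro anticode_A'_is_anticode) auto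
  fix B assume "is_anticode q n (2 * (k - t)) k B"
  then show "card B \<le> card (anticode_A' q t k n)"
    using assms n anticode_card_le[of q t k n B] by (simp add: card_anticode_A')
qed

end
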